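(* Let $K(z,w)$ be a positive definite kernel on a set $\Omega$, and let $\mathcal H(K)$ be the associated reproducing kernel Hilbert space. Let $M\in\mathbb N$, let $(w_1,x_1),\ldots,(w_M,x_M)\in\Omega\times\mathbb C$, and set $$\mathbf x=\begin{pmatrix}x_1\\ x_2\\ \vdots\\ x_M\end{pmatrix}\in\mathbb C^M,\qquad P=(K(w_j,w_k))_{j,k=1,\ldots,M}\ge 0.$$ A necessary and sufficient condition for the existence of $f\in\mathcal H(K)$ such that $$f(w_m)=x_m,\quad m=1,\ldots,M,\qquad\text{and}\qquad \|f\|_{\mathcal H(K)}\le 1$$ is that $$P-\mathbf x\mathbf x^*\ge 0.$$
   Context: A complex-valued kernel $K$ is positive definite on $\Omega$ if for every $q\in\mathbb N$ and $z_1,\ldots,z_q\in\Omega$ the $q\times q$ matrix with $(j,k)$ entry $K(z_j,z_k)$ is (Hermitian) non-negative. The reproducing kernel Hilbert space $\mathcal H(K)$ consists of complex-valued functions on $\Omega$, contains each function $K(\cdot,w)$, $w\in\Omega$, and satisfies $f(w)=\langle f,K(\cdot,w)\rangle_{\mathcal H(K)}$ for all $f\in\mathcal H(K)$. For Hermitian matrices, $A\ge0$ means that $A$ is positive semidefinite, and $\mathbf x^*$ is the conjugate transpose of $\mathbf x$. *)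

theory Defs
  imports "Jordan_Normal_Form.Schur_Decomposition"
begin

text \<open>The quadratic form is \<open>v\<^sup>* A v = (A v) \<bullet>c v\<close>; \<open>0 \<le> z\<close> in the order on
  \<^typ>\<open>complex\<close> says that \<open>z\<close> is real and nonnegative.\<close>

definition positive_semidefinite :: "complex mat \<Rightarrow> bool" where
  "positive_semidefinite A \<longleftrightarrow>
     square_mat A \<and> mat_adjoint A = A \<and>
     (\<forall>v \<in> carrier_vec (dim_row A). 0 \<le> (A *\<^sub>v v) \<bullet>c v)"

definition kernel_mat :: "('a \<Rightarrow> 'a \<Rightarrow> complex) \<Rightarrow> nat \<Rightarrow> (nat \<Rightarrow> 'a) \<Rightarrow> complex mat" where
  "kernel_mat K q z = mat q q (\<lambda>(j, k). K (z j) (z k))"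

definition positive_definite_kernel :: "'a set \<Rightarrow> ('a \<Rightarrow> 'a \<Rightarrow> complex) \<Rightarrow> bool" where
  "positive_definite_kernel \<Omega> K \<longleftrightarrow>
     (\<forall>q z. (\<forall>j<q. z j \<in> \<Omega>) \<longrightarrow> positive_semidefinite (kernel_mat K q z))"

definition col_vec_mat :: "complex vec \<Rightarrow> complex mat" where
  "col_vec_mat x = mat_of_cols (dim_vec x) [x]"

definition ip_norm :: "('f \<Rightarrow> 'f \<Rightarrow> complex) \<Rightarrow> 'f \<Rightarrow> real" where
  "ip_norm ip f = sqrt (Re (ip f f))"

text \<open>Functions on a set \<open>\<Omega>\<close> are represented by total functions that vanish outside \<open>\<Omega>\<close>,
  so that equality on \<open>\<Omega>\<close> is equality and pointwise operations need no restriction.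
  The inner product is linear in its first argument and unspecified outside \<open>H\<close>.\<close>

locale hilbert_function_space =
  fixes \<Omega> :: "'a set"
    and H :: "('a \<Rightarrow> complex) set"
    and ip :: "('a \<Rightarrow> complex) \<Rightarrow> ('a \<Rightarrow> complex) \<Rightarrow> complex"
  assumes vanishes_outside: "f \<in> H \<Longrightarrow> z \<notin> \<Omega> \<Longrightarrow> f z = 0"
    and zero_mem: "(\<lambda>z. 0) \<in> H"
    and add_mem: "f \<in> H \<Longrightarrow> g \<in> H \<Longrightarrow> (\<lambda>z. f z + g z) \<in> H"
    and scale_mem: "f \<in> H \<Longrightarrow> (\<lambda>z. c * f z) \<in> H"
    and ip_add: "f \<in> H \<Longrightarrow> g \<in> H \<Longrightarrow> h \<in> H \<Longrightarrow> ip (\<lambda>z. f z + g z) h = ip f h + ip g h"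
    and ip_scale: "f \<in> H \<Longrightarrow> g \<in> H \<Longrightarrow> ip (\<lambda>z. c * f z) g = c * ip f g"
    and ip_commute: "f \<in> H \<Longrightarrow> g \<in> H \<Longrightarrow> ip g f = cnj (ip f g)"
    and ip_nonneg: "f \<in> H \<Longrightarrow> 0 \<le> ip f f"
    and ip_definite: "f \<in> H \<Longrightarrow> ip f f = 0 \<Longrightarrow> f = (\<lambda>z. 0)"
    and complete:
      "(\<And>n. F n \<in> H) \<Longrightarrow>
       (\<And>e. e > 0 \<Longrightarrow> \<exists>N. \<forall>m\<ge>N. \<forall>n\<ge>N. ip_norm ip (\<lambda>z. F m z - F n z) < e) \<Longrightarrow>
       \<exists>f\<in>H. (\<lambda>n. ip_norm ip (\<lambda>z. F n z - f z)) \<longlonglongrightarrow> 0"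

text \<open>\<open>K(\<sqdot>, w)\<close> as a function on \<open>\<Omega>\<close>, under the same representation.\<close>

definition kernel_section :: "'a set \<Rightarrow> ('a \<Rightarrow> 'a \<Rightarrow> complex) \<Rightarrow> 'a \<Rightarrow> 'a \<Rightarrow> complex" where
  "kernel_section \<Omega> K w = (\<lambda>z. if z \<in> \<Omega> then K z w else 0)"

text \<open>By the Moore--Aronszajn theorem, a positive definite kernel \<open>K\<close> on \<open>\<Omega>\<close> determines
  \<open>H\<close> and the restriction of \<open>ip\<close> to \<open>H\<close> uniquely, and such \<open>H\<close> and \<open>ip\<close> exist.\<close>

locale reproducing_kernel_hilbert_space =
  hilbert_function_space \<Omega> H ip
  for \<Omega> :: "'a set" and K :: "'a \<Rightarrow> 'a \<Rightarrow> complex" and H and ip +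
  assumes kernel_section_mem: "w \<in> \<Omega> \<Longrightarrow> kernel_section \<Omega> K w \<in> H"
    and reproducing: "f \<in> H \<Longrightarrow> w \<in> \<Omega> \<Longrightarrow> f w = ip f (kernel_section \<Omega> K w)"

end

theory Submission
  imports Defs
begin

text \<open>Write \<open>k\<^sub>m = K(\<sqdot>, w\<^sub>m)\<close> and, for coefficients \<open>v\<close>, \<open>g\<^sub>v = \<Sum> v\<^sub>m k\<^sub>m\<close>.  The
  reproducing property turns \<open>P\<close> into a Gram matrix, so \<open>v\<^sup>* P v = \<parallel>g\<^sub>v\<parallel>\<^sup>2\<close>, and the condition
  \<open>P - x x\<^sup>* \<ge> 0\<close> says exactly that
  \<open>|\<Sum> x\<^sub>m cnj v\<^sub>m|\<^sup>2 \<le> \<parallel>g\<^sub>v\<parallel>\<^sup>2\<close> for all \<open>v\<close> (lemma \<open>psd_iff_functional_bound\<close>).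

  If \<open>f\<close> interpolates, the sum on the left is \<open>\<langle>f, g\<^sub>v\<rangle>\<close>, and the bound is the
  Cauchy--Schwarz inequality for \<open>\<parallel>f\<parallel> \<le> 1\<close>.

  Conversely, the bound shows that \<open>\<Sum> x\<^sub>m cnj v\<^sub>m\<close> vanishes whenever \<open>g\<^sub>v\<close> does.  This is
  the only obstruction to finding some \<open>f = g\<^sub>c\<close> in the span of the \<open>k\<^sub>m\<close> with
  \<open>\<langle>f, k\<^sub>m\<rangle> = x\<^sub>m\<close> for all \<open>m\<close> (lemma \<open>moment_problem_in_span\<close>, a Gram--Schmidt induction).
  For this \<open>f\<close> one has \<open>\<parallel>f\<parallel>\<^sup>2 = \<langle>f, g\<^sub>c\<rangle> = \<Sum> x\<^sub>m cnj c\<^sub>m\<close>, so the bound at \<open>v = c\<close> reads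
  \<open>\<parallel>f\<parallel>\<^sup>4 \<le> \<parallel>f\<parallel>\<^sup>2\<close>, that is, \<open>\<parallel>f\<parallel> \<le> 1\<close>.\<close>

section \<open>Moment problems in a Hilbert space of functions\<close>

definition combination :: "nat \<Rightarrow> (nat \<Rightarrow> complex) \<Rightarrow> (nat \<Rightarrow> 'a \<Rightarrow> complex) \<Rightarrow> 'a \<Rightarrow> complex"
  where "combination n c k = (\<lambda>z. \<Sum>j<n. c j * k j z)"

lemma combination_0: "combination 0 c k = (\<lambda>z. 0)"
  by (simp add: combination_def)

lemma combination_Suc:
  "combination (Suc n) c k = (\<lambda>z. combination n c k z + c n * k n z)"
  by (simp add: combination_def)

context hilbert_function_space
begin

lemma ip_add_right:
  assumes "f \<in> H" "g \<in> H" "h \<in> H"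
  shows "ip h (\<lambda>z. f z + g z) = ip h f + ip h g"
  using ip_commute[OF add_mem[OF assms(1,2)] assms(3)] ip_commute[OF assms(1,3)]
    ip_commute[OF assms(2,3)] ip_add[OF assms] by simp

lemma ip_scale_right:
  assumes "f \<in> H" "g \<in> H"
  shows "ip g (\<lambda>z. c * f z) = cnj c * ip g f"
  using ip_commute[OF scale_mem[OF assms(1)] assms(2)] ip_commute[OF assms]
    ip_scale[OF assms] by simp

lemma ip_zero_left: "h \<in> H \<Longrightarrow> ip (\<lambda>z. 0) h = 0"
  using ip_scale[of h h 0] by simp

lemma ip_zero_right: "h \<in> H \<Longrightarrow> ip h (\<lambda>z. 0) = 0"
  using ip_scale_right[of h h 0] by simp

lemma combination_mem:
  assumes "\<And>j. j < n \<Longrightarrow> k j \<in> H"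
  shows "combination n c k \<in> H"
  using assms
  by (induction n) (simp_all add: combination_0 combination_Suc zero_mem add_mem scale_mem)

lemma ip_combination_left:
  assumes "\<And>j. j < n \<Longrightarrow> k j \<in> H" "h \<in> H"
  shows "ip (combination n c k) h = (\<Sum>j<n. c j * ip (k j) h)"
  using assms
  by (induction n)
    (simp_all add: combination_0 combination_Suc ip_zero_left ip_add ip_scale scale_mem
      combination_mem)

lemma ip_combination_right:
  assumes "\<And>j. j < n \<Longrightarrow> k j \<in> H" "h \<in> H"
  shows "ip h (combination n c k) = (\<Sum>j<n. ip h (k j) * cnj (c j))"
  using assms
  by (induction n)
    (simp_all add: combination_0 combination_Suc ip_zero_right ip_add_right ip_scale_right
      scale_mem combination_mem mult.commute)

lemma ip_self_real:
  assumes "f \<in> H"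
  shows "ip f f = of_real (Re (ip f f))" "0 \<le> Re (ip f f)"
  using ip_nonneg[OF assms] by (auto simp: less_eq_complex_def complex_eq_iff)

text \<open>Cauchy--Schwarz for a vector of norm at most one.  Expanding
  \<open>0 \<le> \<parallel>g - \<langle>g, f\<rangle> f\<parallel>\<^sup>2\<close> gives \<open>(2 - \<parallel>f\<parallel>\<^sup>2) |\<langle>f, g\<rangle>|\<^sup>2 \<le> \<parallel>g\<parallel>\<^sup>2\<close>; this avoids dividing
  by a norm that may be zero.\<close>

lemma norm_ip_le_of_unit_ball:
  assumes f: "f \<in> H" and g: "g \<in> H" and le: "Re (ip f f) \<le> 1"
  shows "(cmod (ip f g))\<^sup>2 \<le> Re (ip g g)"
proof -
  define a where "a = - ip g f"
  define h where "h = (\<lambda>z. g z + a * f z)"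
  have af: "(\<lambda>z. a * f z) \<in> H" and h: "h \<in> H"
    using f g by (auto simp: h_def add_mem scale_mem)
  have fg: "ip f g = - cnj a"
    using ip_commute[OF g f] by (simp add: a_def)
  have "ip h h = ip g g + cnj a * ip g f + a * (ip f g + cnj a * ip f f)"
    using f g af h unfolding h_def
    by (simp add: ip_add ip_add_right ip_scale ip_scale_right scale_mem add_mem algebra_simps)
  also have "\<dots> = ip g g - 2 * (a * cnj a) + (a * cnj a) * ip f f"
    by (simp add: fg a_def algebra_simps)
  also have "\<dots> = ip g g - 2 * of_real ((cmod a)\<^sup>2) + of_real ((cmod a)\<^sup>2) * ip f f"
    by (simp only: complex_norm_square)
  finally have "Re (ip h h) = Re (ip g g) - 2 * (cmod a)\<^sup>2 + (cmod a)\<^sup>2 * Re (ip f f)"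
    by simp
  moreover have "(cmod a)\<^sup>2 * Re (ip f f) \<le> (cmod a)\<^sup>2"
    using mult_left_mono[OF le, of "(cmod a)\<^sup>2"] by simp
  moreover have "0 \<le> Re (ip h h)"
    using ip_self_real[OF h] by simp
  ultimately show ?thesis
    by (simp add: fg)
qed

text \<open>Prescribed inner products with finitely many vectors can be attained in their span as
  soon as they respect the linear relations between the vectors.  In the inductive step, the
  induction hypothesis is used twice: it solves the smaller problem, and it produces the
  orthogonal projection \<open>p\<close> of the new vector onto the span of the old ones.  Adding a multiple of
  \<open>k\<^sub>n - p\<close> corrects the last inner product without changing the others; if \<open>k\<^sub>n = p\<close>, the last
  equation already follows from the earlier ones.\<close>

lemma moment_problem_in_span:
  assumes "\<And>j. j < n \<Longrightarrow> k j \<in> H"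
    and "\<And>v. combination n v k = (\<lambda>z. 0) \<Longrightarrow> (\<Sum>j<n. x j * cnj (v j)) = 0"
  shows "\<exists>c. \<forall>j<n. ip (combination n c k) (k j) = x j"
  using assms
proof (induction n arbitrary: x)
  case 0
  then show ?case by simp
next
  case (Suc n)
  have k: "k j \<in> H" if "j < n" for j
    using Suc.prems(1) that by simp
  have kn: "k n \<in> H"
    using Suc.prems(1) by simp
  have "\<exists>b. \<forall>j<n. ip (combination n b k) (k j) = ip (k n) (k j)"
  proof (rule Suc.IH)
    fix v assume "combination n v k = (\<lambda>z. 0)"
    then show "(\<Sum>j<n. ip (k n) (k j) * cnj (v j)) = 0"
      using ip_combination_right[of n k "k n" v] k kn by (simp add: ip_zero_right)
  qed (use k in simp)
  then obtain b where b: "\<And>j. j < n \<Longrightarrow> ip (combination n b k) (k j) = ip (k n) (k j)"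
    by blast
  have "\<exists>c. \<forall>j<n. ip (combination n c k) (k j) = x j"
  proof (rule Suc.IH)
    fix v assume v: "combination n v k = (\<lambda>z. 0)"
    have "combination (Suc n) (v(n := 0)) k = combination n v k"
      by (simp add: combination_def)
    from Suc.prems(2)[OF trans[OF this v]] show "(\<Sum>j<n. x j * cnj (v j)) = 0"
      by simp
  qed (use k in simp)
  then obtain c where c: "\<And>j. j < n \<Longrightarrow> ip (combination n c k) (k j) = x j"
    by blast
  define p where "p = combination n b k"
  define g where "g = combination n c k"
  \<comment> \<open>Written with a scalar multiple, the form to which the linearity assumptions apply.\<close>
  define e where "e = (\<lambda>z. k n z + (-1) * p z)"
  have p: "p \<in> H" and g: "g \<in> H"
    using k by (auto simp: p_def g_def combination_mem)
  have mp: "(\<lambda>z. (-1) * p z) \<in> H"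
    by (rule scale_mem[OF p])
  have e: "e \<in> H"
    unfolding e_def by (rule add_mem[OF kn mp])
  have ip_e: "ip e h = ip (k n) h - ip p h" if "h \<in> H" for h
    unfolding e_def by (simp only: ip_add[OF kn mp that] ip_scale[OF p that]) simp
  have e_orth: "ip e (k j) = 0" if "j < n" for j
    using ip_e[OF k[OF that]] b[OF that] by (simp add: p_def)
  have "ip e p = 0"
    unfolding p_def using ip_combination_right[of n k e b] k e e_orth by simp
  moreover have "ip e e = ip e (k n) - ip e p"
    using ip_add_right[OF kn mp e] ip_scale_right[OF p e, of "-1"] by (simp add: e_def)
  ultimately have e_kn: "ip e (k n) = ip e e"
    by simp
  show ?case
  proof (cases "ip e e = 0")
    case True
    \<comment> \<open>The linear relation \<open>k\<^sub>n - p = 0\<close> forces \<open>x n\<close> to be the value that \<open>g\<close> attains.\<close>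
    have e0: "e = (\<lambda>z. 0)"
      by (rule ip_definite[OF e True])
    have comb: "combination (Suc n) ((\<lambda>j. - b j)(n := 1)) k = e"
      by (simp add: combination_def e_def p_def fun_eq_iff sum_negf)
    have "(\<Sum>j<Suc n. x j * cnj (((\<lambda>j. - b j)(n := 1)) j)) = 0"
      by (rule Suc.prems(2)) (simp only: comb e0)
    then have "x n = (\<Sum>j<n. x j * cnj (b j))"
      by (simp add: sum_negf)
    also have "\<dots> = ip g p"
      unfolding p_def using ip_combination_right[of n k g b] k g c by (simp add: g_def)
    also have "p = k n"
      using e0 by (auto simp: e_def fun_eq_iff)
    finally have "ip g (k n) = x n" by simp
    moreover have "combination (Suc n) (c(n := 0)) k = g"
      by (simp add: combination_def g_def)
    ultimately have "\<forall>j<Suc n. ip (combination (Suc n) (c(n := 0)) k) (k j) = x j"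
      using c by (auto simp: g_def less_Suc_eq)
    then show ?thesis by blast
  next
    case False
    define a where "a = (x n - ip g (k n)) / ip e e"
    define d where "d = (\<lambda>j. c j - a * b j)(n := a)"
    have d: "combination (Suc n) d k = (\<lambda>z. g z + a * e z)"
      by (simp add: combination_def d_def g_def e_def p_def fun_eq_iff algebra_simps
          sum_subtractf sum_negf sum_distrib_left)
    have ip_d: "ip (combination (Suc n) d k) h = ip g h + a * ip e h" if "h \<in> H" for h
      unfolding d by (simp only: ip_add[OF g scale_mem[OF e] that] ip_scale[OF e that])
    have "ip (combination (Suc n) d k) (k n) = x n"
      using False by (simp add: ip_d[OF kn] e_kn a_def)
    moreover have "ip (combination (Suc n) d k) (k j) = x j" if "j < n" for j
      using that by (simp add: ip_d[OF k] e_orth g_def c)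
    ultimately have "\<forall>j<Suc n. ip (combination (Suc n) d k) (k j) = x j"
      by (auto simp: less_Suc_eq)
    then show ?thesis by blast
  qed
qed

text \<open>A solution \<open>f\<close> represents the functional \<open>g\<^sub>v \<mapsto> \<Sum> x\<^sub>j cnj v\<^sub>j\<close> on the span, so this functional
  has norm at most \<open>\<parallel>f\<parallel>\<close>.  For \<open>f\<close> in the span the norms agree, because \<open>f\<close> is itself
  a test vector.\<close>

lemma moment_problem_in_unit_ball_iff:
  assumes k: "\<And>j. j < n \<Longrightarrow> k j \<in> H"
  shows "(\<exists>f\<in>H. (\<forall>j<n. ip f (k j) = x j) \<and> ip_norm ip f \<le> 1) \<longleftrightarrow>
    (\<forall>v. (cmod (\<Sum>j<n. x j * cnj (v j)))\<^sup>2
      \<le> Re (ip (combination n v k) (combination n v k)))"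
    (is "_ \<longleftrightarrow> (\<forall>v. ?bound v)")
proof
  assume "\<exists>f\<in>H. (\<forall>j<n. ip f (k j) = x j) \<and> ip_norm ip f \<le> 1"
  then obtain f where f: "f \<in> H" "\<And>j. j < n \<Longrightarrow> ip f (k j) = x j" "Re (ip f f) \<le> 1"
    by (auto simp: ip_norm_def)
  show "\<forall>v. ?bound v"
  proof
    fix v
    have "ip f (combination n v k) = (\<Sum>j<n. x j * cnj (v j))"
      using ip_combination_right[of n k f v] k f by simp
    then show "?bound v"
      using norm_ip_le_of_unit_ball[OF f(1) combination_mem f(3), of n k v] k by simp
  qed
next
  assume bound: "\<forall>v. ?bound v"
  have "\<exists>c. \<forall>j<n. ip (combination n c k) (k j) = x j"
  proof (rule moment_problem_in_span)
    fix v assume v: "combination n v k = (\<lambda>z. 0)"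
    have "?bound v" using bound by blast
    then show "(\<Sum>j<n. x j * cnj (v j)) = 0"
      by (simp add: v ip_zero_left zero_mem)
  qed (use k in simp)
  then obtain c where c: "\<And>j. j < n \<Longrightarrow> ip (combination n c k) (k j) = x j"
    by blast
  define f where "f = combination n c k"
  have f: "f \<in> H"
    using k by (simp add: f_def combination_mem)
  have ff: "ip f f = (\<Sum>j<n. x j * cnj (c j))"
    using ip_combination_right[of n k f c] k f c by (simp add: f_def)
  have "?bound c"
    using bound by blast
  then have "(cmod (ip f f))\<^sup>2 \<le> Re (ip f f)"
    unfolding f_def[symmetric] ff[symmetric] .
  moreover have "cmod (ip f f) = Re (ip f f)"
    using ip_self_real[OF f] by (metis abs_of_nonneg norm_of_real)
  ultimately have "Re (ip f f) * Re (ip f f) \<le> Re (ip f f) * 1"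
    by (simp add: power2_eq_square)
  then have "Re (ip f f) \<le> 1"
    using ip_self_real(2)[OF f] by (cases "Re (ip f f) = 0") auto
  then show "\<exists>f\<in>H. (\<forall>j<n. ip f (k j) = x j) \<and> ip_norm ip f \<le> 1"
    using f c by (auto simp: f_def ip_norm_def)
qed

end

section \<open>The quadratic form of a kernel matrix minus a rank-one matrix\<close>

lemma dim_mat_adjoint:
  "dim_row (mat_adjoint A) = dim_col A"
  "dim_col (mat_adjoint A) = dim_row A"
  by (simp_all add: mat_adjoint_def)

lemma index_mat_adjoint:
  assumes "i < dim_col A" "j < dim_row A"
  shows "mat_adjoint A $$ (i, j) = cnj (A $$ (j, i))"
  using assms by (simp add: mat_adjoint_def mat_of_rows_def)

lemma index_outer_product:
  assumes "j < dim_vec x" "k < dim_vec x"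
  shows "(col_vec_mat x * mat_adjoint (col_vec_mat x)) $$ (j, k) = x $ j * cnj (x $ k)"
  using assms
  by (simp add: col_vec_mat_def scalar_prod_def index_mat_adjoint mat_of_cols_def mat_adjoint_def
      mat_of_rows_def)

lemma dim_outer_product:
  "dim_row (col_vec_mat x * mat_adjoint (col_vec_mat x)) = dim_vec x"
  "dim_col (col_vec_mat x * mat_adjoint (col_vec_mat x)) = dim_vec x"
  by (simp_all add: col_vec_mat_def mat_adjoint_def)

lemma dim_kernel_minus_outer:
  assumes "x \<in> carrier_vec M"
  shows
    "dim_row (kernel_mat K M w - col_vec_mat x * mat_adjoint (col_vec_mat x)) = M"
    "dim_col (kernel_mat K M w - col_vec_mat x * mat_adjoint (col_vec_mat x)) = M"
  using assms dim_outer_product[of x] by auto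

lemma index_kernel_minus_outer:
  assumes "x \<in> carrier_vec M" "j < M" "k < M"
  shows "(kernel_mat K M w - col_vec_mat x * mat_adjoint (col_vec_mat x)) $$ (j, k) =
    K (w j) (w k) - x $ j * cnj (x $ k)"
  using assms index_outer_product[of j x k]
  by (simp add: dim_outer_product kernel_mat_def del: index_mult_mat)

lemma quadratic_form_kernel_minus_outer:
  assumes x: "x \<in> carrier_vec M" and v: "v \<in> carrier_vec M"
  shows "((kernel_mat K M w - col_vec_mat x * mat_adjoint (col_vec_mat x)) *\<^sub>v v) \<bullet>c v =
    (\<Sum>j<M. \<Sum>k<M. K (w j) (w k) * v $ k * cnj (v $ j))
      - of_real ((cmod (\<Sum>j<M. x $ j * cnj (v $ j)))\<^sup>2)"
proof -
  let ?A = "kernel_mat K M w - col_vec_mat x * mat_adjoint (col_vec_mat x)"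
  note dims = dim_kernel_minus_outer[OF x, of K w]
    and entry = index_kernel_minus_outer[OF x, of _ _ K w]
  have "(?A *\<^sub>v v) \<bullet>c v = (\<Sum>j<M. (\<Sum>k<M. ?A $$ (j, k) * v $ k) * cnj (v $ j))"
    using v dims by (auto simp: scalar_prod_def lessThan_atLeast0 simp del: index_minus_mat
        intro!: sum.cong)
  also have "\<dots> = (\<Sum>j<M. \<Sum>k<M. K (w j) (w k) * v $ k * cnj (v $ j))
      - (\<Sum>j<M. \<Sum>k<M. (x $ j * cnj (v $ j)) * cnj (x $ k * cnj (v $ k)))"
    unfolding sum_distrib_right sum_subtractf[symmetric]
    by (intro sum.cong refl) (simp add: entry algebra_simps del: index_minus_mat)
  also have "(\<Sum>j<M. \<Sum>k<M. (x $ j * cnj (v $ j)) * cnj (x $ k * cnj (v $ k)))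
      = of_real ((cmod (\<Sum>j<M. x $ j * cnj (v $ j)))\<^sup>2)"
    by (simp only: complex_norm_square cnj_sum sum_product)
  finally show ?thesis .
qed

section \<open>Interpolation in a reproducing kernel Hilbert space\<close>

context reproducing_kernel_hilbert_space
begin

lemma kernel_eq_ip_sections:
  assumes "u \<in> \<Omega>" "v \<in> \<Omega>"
  shows "K u v = ip (kernel_section \<Omega> K v) (kernel_section \<Omega> K u)"
  using reproducing[OF kernel_section_mem[OF assms(2)] assms(1)] assms
  by (simp add: kernel_section_def)

lemma kernel_hermitian:
  assumes "u \<in> \<Omega>" "v \<in> \<Omega>"
  shows "cnj (K u v) = K v u"
  using ip_commute[OF kernel_section_mem[OF assms(2)] kernel_section_mem[OF assms(1)]] assms
  by (simp add: kernel_eq_ip_sections)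

text \<open>The kernel matrix is the Gram matrix of the kernel sections.\<close>

lemma kernel_form_eq_norm:
  assumes "\<And>m. m < M \<Longrightarrow> w m \<in> \<Omega>"
  shows "(\<Sum>j<M. \<Sum>k<M. K (w j) (w k) * v k * cnj (v j)) =
    ip (combination M v (\<lambda>m. kernel_section \<Omega> K (w m)))
      (combination M v (\<lambda>m. kernel_section \<Omega> K (w m)))"
  using assms
  by (simp add: ip_combination_right ip_combination_left combination_mem kernel_section_mem
      kernel_eq_ip_sections sum_distrib_right sum_distrib_left mult_ac)

text \<open>The function-space form of the matrix condition.  The order on \<^typ>\<open>complex\<close> demands a real
  quadratic form; it is one because \<open>\<langle>g, g\<rangle>\<close> is real.\<close>

lemma psd_iff_functional_bound:
  assumes w: "\<And>m. m < M \<Longrightarrow> w m \<in> \<Omega>" and x: "x \<in> carrier_vec M"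
  shows "positive_semidefinite (kernel_mat K M w - col_vec_mat x * mat_adjoint (col_vec_mat x))
    \<longleftrightarrow> (\<forall>v. (cmod (\<Sum>j<M. x $ j * cnj (v j)))\<^sup>2
      \<le> Re (ip (combination M v (\<lambda>m. kernel_section \<Omega> K (w m)))
              (combination M v (\<lambda>m. kernel_section \<Omega> K (w m)))))"
    (is "positive_semidefinite ?A \<longleftrightarrow> (\<forall>v. ?bound v)")
proof -
  let ?g = "\<lambda>v. combination M v (\<lambda>m. kernel_section \<Omega> K (w m))"
  note dims = dim_kernel_minus_outer[OF x, of K w]
    and entry = index_kernel_minus_outer[OF x, of _ _ K w]
  have adj: "mat_adjoint ?A = ?A"
  proof (rule eq_matI)
    fix i j assume "i < dim_row ?A" "j < dim_col ?A"
    then have ij: "i < M" "j < M"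
      by (simp_all only: dims)
    have "mat_adjoint ?A $$ (i, j) = cnj (?A $$ (j, i))"
      using ij by (intro index_mat_adjoint) (simp_all only: dims)
    also have "\<dots> = ?A $$ (i, j)"
      unfolding entry[OF ij] entry[OF ij(2,1)]
      using ij w by (simp add: kernel_hermitian mult.commute)
    finally show "mat_adjoint ?A $$ (i, j) = ?A $$ (i, j)" .
  next
    show "dim_row (mat_adjoint ?A) = dim_row ?A" "dim_col (mat_adjoint ?A) = dim_col ?A"
      by (simp_all only: dim_mat_adjoint dims)
  qed
  have form: "0 \<le> (?A *\<^sub>v v) \<bullet>c v \<longleftrightarrow> ?bound (\<lambda>j. v $ j)" if "v \<in> carrier_vec M" for v
  proof -
    have "?g (\<lambda>j. v $ j) \<in> H"
      using w by (simp add: combination_mem kernel_section_mem)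
    then have "Im (ip (?g (\<lambda>j. v $ j)) (?g (\<lambda>j. v $ j))) = 0"
      using ip_nonneg by (simp add: less_eq_complex_def)
    moreover have "(\<Sum>j<M. \<Sum>k<M. K (w j) (w k) * v $ k * cnj (v $ j))
        = ip (?g (\<lambda>j. v $ j)) (?g (\<lambda>j. v $ j))"
      by (rule kernel_form_eq_norm) (rule w)
    ultimately show ?thesis
      unfolding quadratic_form_kernel_minus_outer[OF x that]
      by (simp add: less_eq_complex_def)
  qed
  have "positive_semidefinite ?A \<longleftrightarrow> (\<forall>v\<in>carrier_vec M. ?bound (\<lambda>j. v $ j))"
    unfolding positive_semidefinite_def using adj form by (simp only: dims square_mat.simps) simp
  also have "\<dots> \<longleftrightarrow> (\<forall>v. ?bound v)"
  proof
    assume bound: "\<forall>v\<in>carrier_vec M. ?bound (\<lambda>j. v $ j)"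
    show "\<forall>v. ?bound v"
    proof
      fix v
      have "?bound (\<lambda>j. vec M v $ j)"
        using bound by (metis vec_carrier)
      moreover have "?g (\<lambda>j. vec M v $ j) = ?g v"
        by (simp add: combination_def)
      ultimately show "?bound v" by simp
    qed
  qed blast
  finally show ?thesis .
qed

end

theorem proposition3p2:
  fixes \<Omega> :: "'a set"
    and K :: "'a \<Rightarrow> 'a \<Rightarrow> complex"
    and H :: "('a \<Rightarrow> complex) set"
    and ip :: "('a \<Rightarrow> complex) \<Rightarrow> ('a \<Rightarrow> complex) \<Rightarrow> complex"
    and M :: nat
    and w :: "nat \<Rightarrow> 'a"
    and x :: "complex vec"
  assumes "positive_definite_kernel \<Omega> K"
    and "reproducing_kernel_hilbert_space \<Omega> K H ip"
    and "\<And>m. m < M \<Longrightarrow> w m \<in> \<Omega>"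
    and "x \<in> carrier_vec M"
  shows "(\<exists>f\<in>H. (\<forall>m<M. f (w m) = x $ m) \<and> ip_norm ip f \<le> 1) \<longleftrightarrow>
    positive_semidefinite (kernel_mat K M w - col_vec_mat x * mat_adjoint (col_vec_mat x))"
proof -
  interpret reproducing_kernel_hilbert_space \<Omega> K H ip
    by (rule assms(2))
  have "(\<exists>f\<in>H. (\<forall>m<M. f (w m) = x $ m) \<and> ip_norm ip f \<le> 1) \<longleftrightarrow>
      (\<exists>f\<in>H. (\<forall>m<M. ip f (kernel_section \<Omega> K (w m)) = x $ m) \<and> ip_norm ip f \<le> 1)"
    using assms(3) by (simp add: reproducing[symmetric] cong: bex_cong)
  also have "\<dots> \<longleftrightarrow> (\<forall>v. (cmod (\<Sum>j<M. x $ j * cnj (v j)))\<^sup>2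
      \<le> Re (ip (combination M v (\<lambda>m. kernel_section \<Omega> K (w m)))
              (combination M v (\<lambda>m. kernel_section \<Omega> K (w m)))))"
    using assms(3) by (intro moment_problem_in_unit_ball_iff kernel_section_mem)
  also have "\<dots> \<longleftrightarrow>
      positive_semidefinite (kernel_mat K M w - col_vec_mat x * mat_adjoint (col_vec_mat x))"
    by (rule psd_iff_functional_bound[symmetric]) (use assms(3,4) in simp_all)
  finally show ?thesis .
qed

end
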